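(* Let $l<u$ and $b>0$ be fixed, and let $d_1,\dots,d_n$ be i.i.d. $\sim U[l,u]$. Then Condat's method, applied to $d=(d_1,\dots,d_n)$ and $b$, has an average runtime of $O(n)$; that is, the expected number of elementary operations it performs is $O(n)$ as $n\to\infty$.
   Context: Problem: compute $\mathrm{proj}_{\Delta_b}(d)=\mathrm{argmin}_{v\in\Delta_b}\|v-d\|_2$, where $\Delta_b=\{v\in\mathbb{R}^n:\sum_i v_i=b,\ v\ge0\}$. There is a unique pivot $\tau\in\mathbb{R}$ with $\mathrm{proj}_{\Delta_b}(d)_i=\max\{d_i-\tau,0\}$ for all $i$. Filter$(d,b)$: Initialize $\mathcal{I}_p:=\{1\}$, $\mathcal{I}_w:=\emptyset$, $p:=d_1-b$. For $i=2,\dots,n$ in order: if $d_i>p$, then set $p:=p+\frac{d_i-p}{|\mathcal{I}_p|+1}$ and then (with the updated $p$) if $p>d_i-b$ set $\mathcal{I}_p:=\mathcal{I}_p\cup\{i\}$, otherwise set $\mathcal{I}_w:=\mathcal{I}_w\cup\mathcal{I}_p$, $\mathcal{I}_p:=\{i\}$, $p:=d_i-b$. Afterwards, for each $i\in\mathcal{I}_w$: if $d_i>p$, set $\mathcal{I}_p:=\mathcal{I}_p\cup\{i\}$ and then $p:=p+\frac{d_i-p}{|\mathcal{I}_p|}$. Return $\mathcal{I}_p$. Condat's method: Set $\mathcal{I}_p:=\mathrm{Filter}(d,b)$ and $p:=(\sum_{i\in\mathcal{I}_p}d_i-b)/|\mathcal{I}_p|$. Repeat: set $\mathcal{I}:=\mathcal{I}_p$;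 run through $i\in\mathcal{I}$ and, whenever $d_i\le p$ for the current $p$, set $\mathcal{I}_p:=\mathcal{I}_p\setminus\{i\}$ and then $p:=p+\frac{p-d_i}{|\mathcal{I}_p|}$; while $|\mathcal{I}|>|\mathcal{I}_p|$. On termination put $\tau:=p$, $\mathcal{I}_\tau:=\mathcal{I}_p$ and return the sparse vector with entries $d_i-\tau$, $i\in\mathcal{I}_\tau$. Cost model: each real arithmetic operation, comparison or assignment costs $O(1)$; one pass of the loop costs $\Theta(|\mathcal{I}|)$. Asymptotics are as $n\to\infty$ with $l,u,b$ fixed. "Average runtime" means expectation of the operation count over the random input $d$. *)

theory Defs
  imports "HOL-Probability.Probability" "HOL-Library.Landau_Symbols"
begin

text \<open>
  The input vector is a function \<open>d\<close> on the indices \<open>1, \<dots>, n\<close>. Index sets are duplicate-free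
  lists, so that a set can be run through; the order in which this happens is not part of the
  method and is left to two parameters: \<open>ordw\<close> rearranges \<open>I_w\<close> before the second loop of Filter,
  \<open>ordp\<close> rearranges \<open>I\<close> before each pass. They are meant to be arbitrary permutations of their
  argument.

  The last component of every state counts elementary operations: one unit for each real
  arithmetic operation, for each comparison, for each assignment (including that of the loop
  variable), for computing \<open>|I_p| + 1\<close>, and for inserting or removing a single index. Forming the
  union \<open>I_w \<union> I_p\<close> or copying an index set \<open>I_p\<close> costs \<open>|I_p|\<close> units.
  The summands of an increment follow the program text: e.g. in \<open>filter_step1\<close>, \<open>2\<close> for advancing
  \<open>i\<close> and testing \<open>d_i > p\<close>, \<open>5\<close> for updating \<open>p\<close>, \<open>2\<close> for testing \<open>p > d_i - b\<close>, and then the branch.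
\<close>

type_synonym filter_state = "nat list \<times> nat list \<times> real \<times> nat"  \<comment> \<open>\<open>(I_p, I_w, p, count)\<close>\<close>
type_synonym pass_state = "nat list \<times> real \<times> nat"  \<comment> \<open>\<open>(I_p, p, count)\<close>\<close>

fun filter_step1 :: "(nat \<Rightarrow> real) \<Rightarrow> real \<Rightarrow> nat \<Rightarrow> filter_state \<Rightarrow> filter_state" where
  "filter_step1 d b i (Ip, Iw, p, c) =
     (if d i > p then
        let p' = p + (d i - p) / real (length Ip + 1) in
        if p' > d i - b
        then (Ip @ [i], Iw, p', c + 2 + 5 + 2 + 1)
        else ([i], Iw @ Ip, d i - b, c + 2 + 5 + 2 + (length Ip + 1 + 2))
      else (Ip, Iw, p, c + 2))"

fun filter_step2 :: "(nat \<Rightarrow> real) \<Rightarrow> nat \<Rightarrow> pass_state \<Rightarrow> pass_state" where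
  "filter_step2 d i (Ip, p, c) =
     (if d i > p then
        let Ip' = Ip @ [i] in (Ip', p + (d i - p) / real (length Ip'), c + 2 + 5)
      else (Ip, p, c + 2))"

definition filter_simplex ::
  "(nat list \<Rightarrow> nat list) \<Rightarrow> nat \<Rightarrow> (nat \<Rightarrow> real) \<Rightarrow> real \<Rightarrow> nat list \<times> nat" where
  "filter_simplex ordw n d b =
     (let (Ip, Iw, p, c) = fold (filter_step1 d b) [2..<n+1] ([1], [], d 1 - b, 4);
          (Ip', p', c') = fold (filter_step2 d) (ordw Iw) (Ip, p, c)
      in (Ip', c'))"

fun condat_step :: "(nat \<Rightarrow> real) \<Rightarrow> nat \<Rightarrow> pass_state \<Rightarrow> pass_state" where
  "condat_step d i (Ip, p, c) =
     (if d i \<le> p then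
        let Ip' = removeAll i Ip in (Ip', p + (p - d i) / real (length Ip'), c + 2 + 5)
      else (Ip, p, c + 2))"

definition condat_pass ::
  "(nat list \<Rightarrow> nat list) \<Rightarrow> (nat \<Rightarrow> real) \<Rightarrow> pass_state \<Rightarrow> pass_state" where
  "condat_pass ordp d = (\<lambda>(Ip, p, c). fold (condat_step d) (ordp Ip) (Ip, p, c + length Ip))"

text \<open>The do-while loop; the extra unit is the comparison \<open>|I| > |I_p|\<close>.\<close>

function condat_loop ::
  "(nat list \<Rightarrow> nat list) \<Rightarrow> (nat \<Rightarrow> real) \<Rightarrow> pass_state \<Rightarrow> pass_state" where
  "condat_loop ordp d (I, p, c) =
     (case condat_pass ordp d (I, p, c) of (Ip', p', c') \<Rightarrow>
        if length I > length Ip' then condat_loop ordp d (Ip', p', c' + 1)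
        else (Ip', p', c' + 1))"
  by pat_completeness auto
termination
  by (relation "Wellfounded.measure (\<lambda>(ordp, d, I, p, c). length I)") auto

text \<open>Condat's method: the sparse vector, as a list of (index, entry) pairs, with the count.\<close>

definition condat ::
  "(nat list \<Rightarrow> nat list) \<Rightarrow> (nat list \<Rightarrow> nat list) \<Rightarrow> nat \<Rightarrow> (nat \<Rightarrow> real) \<Rightarrow> real
     \<Rightarrow> (nat \<times> real) list \<times> nat" where
  "condat ordw ordp n d b =
     (let (Ip, c) = filter_simplex ordw n d b;
          p = ((\<Sum>i\<leftarrow>Ip. d i) - b) / real (length Ip);
          (I\<^sub>\<tau>, \<tau>, c') = condat_loop ordp d (Ip, p, c + length Ip + 3)
      in (map (\<lambda>i. (i, d i - \<tau>)) I\<^sub>\<tau>, c' + 1 + length I\<^sub>\<tau> + 2 * length I\<^sub>\<tau>))"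

definition condat_runtime ::
  "(nat list \<Rightarrow> nat list) \<Rightarrow> (nat list \<Rightarrow> nat list) \<Rightarrow> nat \<Rightarrow> (nat \<Rightarrow> real) \<Rightarrow> real \<Rightarrow> nat" where
  "condat_runtime ordw ordp n d b = snd (condat ordw ordp n d b)"

end

(* Write u - x for the current pivot p. Throughout the loop, I contains all indices with d_i > p and
   p = (sum of d over I - b) / |I|; after a pass started with pivot p, all remaining entries exceed p.
   Put w = u - l and let N_j be the number of entries within w / 2^j of u, with mean n / 2^j. If N_j
   and N_(j+3) are within a factor of their means and n (w / 2^j)^2 is large compared with b w, then
   every pass whose entries lie within x of u, w / 2^(j+1) < x <= w / 2^j, contracts x by a fixed factor
   and costs O(n x / w). This yields a geometric series of total O(n). If x has dropped below order
   sqrt(b w / n), or a count deviates from its mean, the remaining cost is bounded by 9 |I|^2. In the first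
   case this is O(n) plus a squared deviation, in the second it is at most a multiple of the squared
   deviation (N_j - n / 2^j)^2, whose expectation, a variance, is at most n / 2^j. Summing over j
   gives O(n) again. *)
theory Submission
  imports Defs
begin

section \<open>Cost of the pivot iteration\<close>

text \<open>The invariant \<open>p = (sum of d over I - b) / |I|\<close>, written without division.
  \<open>A\<close> holds the indices accounted for so far: it varies during Filter and is
  \<open>{1..n}\<close> in the loop.\<close>

definition balanced :: "(nat \<Rightarrow> real) \<Rightarrow> real \<Rightarrow> nat set \<Rightarrow> nat list \<Rightarrow> real \<Rightarrow> bool" where
  "balanced d b A I p \<longleftrightarrow> distinct I \<and> set I \<subseteq> A
     \<and> (\<Sum>i\<in>set I. d i) = b + real (length I) * p \<and> (\<forall>i\<in>A - set I. d i \<le> p)"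

lemma sum_diff_balanced:
  assumes "balanced d b A I p"
  shows "(\<Sum>i\<in>set I. d i - p) = b"
  using assms by (simp add: balanced_def sum_subtractf distinct_card)

text \<open>The excesses over \<open>p\<close> sum to \<open>b > 0\<close>, so one of them is
  positive. This is what keeps the index list from running empty.\<close>

lemma balanced_obtains_above:
  assumes "balanced d b A I p" "b > 0"
  obtains j where "j \<in> set I" "d j > p"
proof -
  have "\<exists>j\<in>set I. d j > p"
  proof (rule ccontr)
    assume "\<not> ?thesis"
    then have "(\<Sum>i\<in>set I. d i - p) \<le> 0" by (intro sum_nonpos) (simp add: not_less)
    then show False using sum_diff_balanced[OF assms(1)] assms(2) by simp
  qed
  then show ?thesis using that by blast
qed

lemma balanced_nonempty:
  assumes "balanced d b A I p" "b > 0"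
  shows "length I > 0"
  using assms by (elim balanced_obtains_above) auto

text \<open>The new pivot is the mean of \<open>d i\<close> and \<open>length I\<close> copies of
  the old pivot, so the sum identity persists. As the pivot does not decrease, discarded indices
  stay at or below it.\<close>

lemma balanced_append:
  assumes bal: "balanced d b A I p" and "i \<notin> set I" "d i > p"
  shows "balanced d b (insert i A) (I @ [i]) (p + (d i - p) / real (length I + 1))"
    and "p \<le> p + (d i - p) / real (length I + 1)"
proof -
  let ?p = "p + (d i - p) / real (length I + 1)"
  show le: "p \<le> ?p" using assms by simp
  have "real (length I + 1) * ?p = real (length I) * p + d i"
    by (simp add: field_simps)
  then have "(\<Sum>i\<in>set (I @ [i]). d i) = b + real (length (I @ [i])) * ?p"
    using assms by (simp add: balanced_def)
  moreover have "d j \<le> ?p" if "j \<in> insert i A - set (I @ [i])" for j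
  proof -
    have "d j \<le> p" using bal that by (auto simp: balanced_def)
    then show ?thesis using le by linarith
  qed
  ultimately show "balanced d b (insert i A) (I @ [i]) ?p"
    using assms by (auto simp: balanced_def)
qed

lemma balanced_removeAll:
  assumes bal: "balanced d b A I p" and b: "b > 0" and i: "i \<in> set I" "d i \<le> p"
  shows "balanced d b A (removeAll i I) (p + (p - d i) / real (length (removeAll i I)))"
    and "p \<le> p + (p - d i) / real (length (removeAll i I))"
proof -
  let ?I = "removeAll i I"
  let ?p = "p + (p - d i) / real (length ?I)"
  show le: "p \<le> ?p" using assms by simp
  have dist: "distinct I" using bal by (simp add: balanced_def)
  \<comment> \<open>An index above \<open>p\<close> differs from \<open>i\<close>, so the removal
    leaves a nonempty list and the division is not by zero.\<close>
  obtain j where "j \<in> set I" "d j > p" using balanced_obtains_above[OF bal b] .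
  then have "j \<in> set ?I" using i by auto
  then have ne: "?I \<noteq> []" by (auto simp del: set_removeAll)
  have len: "length I = length ?I + 1"
    using dist i by (simp flip: distinct_remove1_removeAll add: length_remove1)
      (metis One_nat_def Suc_pred length_pos_if_in_set)
  have "(\<Sum>j\<in>set ?I. d j) = (\<Sum>j\<in>set I. d j) - d i"
    using i by (simp add: sum_diff1)
  also have "\<dots> = b + (real (length ?I) * p + (p - d i))"
    using bal len by (simp add: balanced_def algebra_simps)
  also have "real (length ?I) * p + (p - d i) = real (length ?I) * ?p"
    using ne by (simp add: field_simps)
  finally have "(\<Sum>j\<in>set ?I. d j) = b + real (length ?I) * ?p" .
  moreover have "\<forall>j\<in>A - set ?I. d j \<le> ?p"
  proof
    fix j assume "j \<in> A - set ?I"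
    then have "d j \<le> p" using bal i by (auto simp: balanced_def)
    then show "d j \<le> ?p" using le by linarith
  qed
  ultimately show "balanced d b A ?I ?p"
    using bal by (auto simp: balanced_def distinct_removeAll)
qed

text \<open>Pivots only grow, so an index that survives its test exceeds the pivot with which the
  fold started. The \<open>7\<close> is the cost \<open>2 + 5\<close> of a removal, the dearer
  branch.\<close>

lemma condat_pass_fold:
  assumes "balanced d b A I p" "b > 0" "distinct xs" "set xs \<subseteq> set I"
    and "fold (condat_step d) xs (I, p, c) = (I', p', c')"
  shows "balanced d b A I' p' \<and> p \<le> p' \<and> set I' \<subseteq> set I \<and> (\<forall>i\<in>set xs \<inter> set I'. p < d i)
           \<and> c' \<le> c + 7 * length xs"
  using assms
proof (induction xs arbitrary: I p c)
  case Nil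
  then show ?case by simp
next
  case (Cons i xs)
  show ?case
  proof (cases "d i \<le> p")
    case True
    let ?I = "removeAll i I"
    let ?p = "p + (p - d i) / real (length ?I)"
    have i: "i \<in> set I" using Cons.prems by simp
    note bal = balanced_removeAll[OF Cons.prems(1,2) i True]
    have "balanced d b A I' p' \<and> ?p \<le> p' \<and> set I' \<subseteq> set ?I \<and> (\<forall>i\<in>set xs \<inter> set I'. ?p < d i)
           \<and> c' \<le> (c + 7) + 7 * length xs"
      by (rule Cons.IH[OF bal(1)]) (use Cons.prems True in \<open>auto simp: Let_def add.commute\<close>)
    moreover have "p < d k" if "k \<in> set (i # xs) \<inter> set I'" for k
    proof -
      have "k \<in> set xs \<inter> set I'" using that calculation by auto
      then have "?p < d k" using calculation by blast
      then show ?thesis using bal(2) by linarith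
    qed
    ultimately show ?thesis using bal(2) by auto
  next
    case False
    have "balanced d b A I' p' \<and> p \<le> p' \<and> set I' \<subseteq> set I \<and> (\<forall>i\<in>set xs \<inter> set I'. p < d i)
           \<and> c' \<le> (c + 2) + 7 * length xs"
      by (rule Cons.IH) (use Cons.prems False in auto)
    then show ?thesis using False by auto
  qed
qed

text \<open>The \<open>8\<close> adds one unit per index for copying \<open>I\<close> to the
  \<open>7\<close> for its test.\<close>

lemma condat_pass_balanced:
  assumes "\<And>xs. mset (ordp xs) = mset xs" "b > 0"
    and "balanced d b A I p" "condat_pass ordp d (I, p, c) = (I', p', c')"
  shows "balanced d b A I' p'" "set I' \<subseteq> set I" "\<And>i. i \<in> set I' \<Longrightarrow> p < d i"
    "c' \<le> c + 8 * length I"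
proof -
  have perm: "distinct (ordp I)" "set (ordp I) = set I" "length (ordp I) = length I"
    using assms mset_eq_imp_distinct_iff mset_eq_setD mset_eq_length
    unfolding balanced_def by metis+
  have *: "balanced d b A I' p' \<and> p \<le> p' \<and> set I' \<subseteq> set I
      \<and> (\<forall>i\<in>set (ordp I) \<inter> set I'. p < d i) \<and> c' \<le> (c + length I) + 7 * length (ordp I)"
    by (rule condat_pass_fold[OF assms(3,2)]) (use perm assms(4) in \<open>auto simp: condat_pass_def\<close>)
  then show "balanced d b A I' p'" "set I' \<subseteq> set I" "\<And>i. i \<in> set I' \<Longrightarrow> p < d i"
    "c' \<le> c + 8 * length I"
    using perm by auto
qed

section \<open>Worst-case cost of the loop\<close>

declare condat_loop.simps [simp del]

lemma condat_loop_pass: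
  assumes "condat_pass ordp d (I, p, c) = (I1, p1, c1)"
  shows "condat_loop ordp d (I, p, c) =
    (if length I > length I1 then condat_loop ordp d (I1, p1, c1 + 1) else (I1, p1, c1 + 1))"
  using assms by (simp add: condat_loop.simps)

lemma condat_loop_cost_square:
  assumes "\<And>xs. mset (ordp xs) = mset xs" "b > 0"
    and "balanced d b A I p" "condat_loop ordp d (I, p, c) = (I', p', c')"
  shows "c' \<le> c + 9 * (length I)\<^sup>2 \<and> length I' \<le> length I"
  using assms(3,4)
proof (induction "length I" arbitrary: I p c rule: less_induct)
  case less
  obtain I1 p1 c1 where pass: "condat_pass ordp d (I, p, c) = (I1, p1, c1)"
    by (metis surj_pair)
  note P = condat_pass_balanced[OF assms(1,2) less.prems(1) pass]
  have pos: "length I > 0" using balanced_nonempty[OF less.prems(1) assms(2)] .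
  show ?case
  proof (cases "length I > length I1")
    case True
    have "c' \<le> (c1 + 1) + 9 * (length I1)\<^sup>2 \<and> length I' \<le> length I1"
      using less.prems(2) True by (intro less.hyps[OF True P(1)]) (simp add: condat_loop_pass[OF pass])
    moreover obtain m where m: "length I = Suc m" using pos by (cases "length I") auto
    moreover have "(length I1)\<^sup>2 \<le> m\<^sup>2" using True m by (intro power_mono) auto
    ultimately show ?thesis using P(4) True by (auto simp: power2_eq_square)
  next
    case False
    then have *: "I' = I1" "c' = c1 + 1"
      using less.prems(2) by (auto simp: condat_loop_pass[OF pass])
    have "length I1 \<le> length I"
      using P(1,2) less.prems(1) unfolding balanced_def by (metis List.finite_set card_mono distinct_card)
    moreover have "length I \<le> (length I)\<^sup>2" unfolding power2_eq_square by (rule le_square)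
    ultimately have "c1 + 1 \<le> c + 9 * (length I)\<^sup>2" using P(4) pos by linarith
    with \<open>length I1 \<le> length I\<close> show ?thesis by (simp add: *)
  qed
qed

section \<open>Cost of the loop at dyadic scales below \<open>u\<close>\<close>

text \<open>This bounds how far \<open>p\<close> lags behind: the elements above \<open>r > p\<close> contribute a large excess
  over \<open>p\<close>, which the elements of \<open>I\<close> below \<open>p\<close> have to compensate up to \<open>b\<close>.\<close>

lemma balanced_excess:
  assumes bal: "balanced d b A I p" and A: "finite A" and r: "p < r" and e: "0 \<le> e"
    and I: "\<And>i. i \<in> set I \<Longrightarrow> p - d i \<le> e"
  shows "(r - p) * real (card {i\<in>A. r \<le> d i}) \<le> b + e * real (length I)"
proof -
  let ?U = "{i\<in>A. r \<le> d i}"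
  \<comment> \<open>Discarded indices have values at most \<open>p < r\<close>, so all of
    \<open>?U\<close> is still in \<open>I\<close>.\<close>
  have U: "?U \<subseteq> set I" using bal r unfolding balanced_def by force
  have "(r - p) * real (card ?U) - e * real (length I) \<le> (\<Sum>i\<in>?U. r - p) - e * card (set I - ?U)"
  proof -
    have "card (set I - ?U) \<le> length I"
      by (meson List.finite_set card_length card_mono Diff_subset order_trans)
    then show ?thesis using e by (simp add: mult.commute mult_left_mono)
  qed
  also have "\<dots> \<le> (\<Sum>i\<in>?U. d i - p) + (\<Sum>i\<in>set I - ?U. d i - p)"
  proof -
    have "(\<Sum>i\<in>?U. r - p) \<le> (\<Sum>i\<in>?U. d i - p)" by (intro sum_mono) auto
    moreover have "(\<Sum>i\<in>set I - ?U. - e) \<le> (\<Sum>i\<in>set I - ?U. d i - p)"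
      using I by (intro sum_mono) (auto simp: algebra_simps)
    ultimately show ?thesis by (simp add: mult.commute)
  qed
  also have "\<dots> = (\<Sum>i\<in>set I. d i - p)"
    using sum.subset_diff[OF U, of "\<lambda>i. d i - p"] by simp
  also have "\<dots> = b" using sum_diff_balanced[OF bal] .
  finally show ?thesis by simp
qed

text \<open>A discrete intermediate value argument; with \<open>a j = w / 2 ^ j\<close> it finds the
  dyadic scale of \<open>x\<close>.\<close>

lemma real_between_consecutive:
  fixes a :: "nat \<Rightarrow> real"
  assumes "x \<le> a 0" "a J < x"
  obtains j where "j < J" "a (Suc j) < x" "x \<le> a j"
proof -
  have "\<exists>j<J. a (Suc j) < x \<and> x \<le> a j"
    using assms
  proof (induction J)
    case (Suc J)
    then show ?case by (cases "a J < x") (auto intro: less_SucI)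
  qed simp
  then show ?thesis using that by blast
qed

text \<open>The term linear in \<open>x\<close> is a potential that pays for contracting passes.
  \<open>E\<close> is carried through the induction unchanged and spent at most once, because the
  quadratic bound settles all remaining passes together.\<close>

lemma condat_loop_cost_dyadic:
  fixes n l u b w :: real and d :: "nat \<Rightarrow> real" and A :: "nat set" and J :: nat
  defines "w \<equiv> u - l"
  defines "N \<equiv> \<lambda>j::nat. real (card {i\<in>A. u - w / 2 ^ j \<le> d i})"
  defines "E \<equiv> 18 * (n / 2 ^ J)\<^sup>2 + 5184 * (\<Sum>j<J+3. (N j - n / 2 ^ j)\<^sup>2)"
  assumes perm: "\<And>xs. mset (ordp xs) = mset xs" and b: "b > 0" and w: "w > 0" and n: "n \<ge> 0"
    and A: "finite A" and J: "\<And>j. j < J \<Longrightarrow> 256 * b * 4 ^ j \<le> w * n"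
    and bal: "balanced d b A I p" and loop: "condat_loop ordp d (I, p, c) = (I', p', c')"
    and x: "0 \<le> x" "x \<le> w" and Ix: "\<And>i. i \<in> set I \<Longrightarrow> u - x \<le> d i"
  shows "real c' \<le> real c + 10800 * n * (x / w) + E"
  using bal loop x Ix
proof (induction "length I" arbitrary: I p c x rule: less_induct)
  case less
  note crude = condat_loop_cost_square[OF perm b less.prems(1,2)]
  have fail_le: "(N j - n / 2 ^ j)\<^sup>2 \<le> (\<Sum>j<J+3. (N j - n / 2 ^ j)\<^sup>2)" if "j < J + 3" for j
    using that by (intro member_le_sum) auto
  have I_le: "real (length I) \<le> N j" if "x \<le> w / 2 ^ j" for j
  proof -
    have "set I \<subseteq> {i\<in>A. u - w / 2 ^ j \<le> d i}"
      using less.prems(1,5) that unfolding balanced_def by force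
    then have "card (set I) \<le> card {i\<in>A. u - w / 2 ^ j \<le> d i}"
      using A by (intro card_mono) auto
    then show ?thesis using less.prems(1) by (simp add: N_def balanced_def distinct_card)
  qed
  have first: "10800 * n * (x / w) \<ge> 0" using n w less.prems(3) by simp
  have by_square: ?case if "9 * (real (length I))\<^sup>2 \<le> E"
  proof -
    have "real c' \<le> real c + 9 * (real (length I))\<^sup>2"
      using crude by (metis (mono_tags, lifting) of_nat_add of_nat_le_iff of_nat_mult of_nat_numeral of_nat_power)
    then show ?thesis using that first by linarith
  qed
  \<comment> \<open>The factor \<open>24\<close> is dictated by the case of a bad count at level
    \<open>j + 3\<close>: there \<open>|I| \<le> 3/2 * n * q = 24 * (n * q / 16)\<close>. Then
    \<open>5184 = 9 * 24^2\<close>.\<close>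
  have by_deviation: ?case if "real (length I) \<le> 24 * \<bar>N j - n / 2 ^ j\<bar>" "j < J + 3" for j
  proof (rule by_square)
    have "(real (length I))\<^sup>2 \<le> (24 * \<bar>N j - n / 2 ^ j\<bar>)\<^sup>2"
      using that(1) by (intro power_mono) auto
    also have "\<dots> = 576 * (N j - n / 2 ^ j)\<^sup>2" by (simp add: power_mult_distrib)
    finally have "9 * (real (length I))\<^sup>2 \<le> 5184 * (N j - n / 2 ^ j)\<^sup>2" by simp
    also have "\<dots> \<le> 5184 * (\<Sum>j<J+3. (N j - n / 2 ^ j)\<^sup>2)" using fail_le[OF that(2)] by simp
    also have "\<dots> \<le> E" by (simp add: E_def)
    finally show "9 * (real (length I))\<^sup>2 \<le> E" .
  qed
  show ?case
  proof (cases "x \<le> w / 2 ^ J")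
    case True
    show ?thesis
    proof (rule by_square)
      have "(real (length I))\<^sup>2 \<le> (N J)\<^sup>2" using I_le[OF True] by (intro power_mono) auto
      \<comment> \<open>The right side minus the left side is the square of
        \<open>N J - 2 * (n / 2 ^ J)\<close>.\<close>
      also have "\<dots> \<le> 2 * (n / 2 ^ J)\<^sup>2 + 2 * (N J - n / 2 ^ J)\<^sup>2"
        using zero_le_power2[of "N J - 2 * (n / 2 ^ J)"]
        by (simp add: power2_eq_square algebra_simps)
      finally have "9 * (real (length I))\<^sup>2 \<le> 18 * (n / 2 ^ J)\<^sup>2 + 18 * (N J - n / 2 ^ J)\<^sup>2"
        by simp
      also have "18 * (N J - n / 2 ^ J)\<^sup>2 \<le> 5184 * (\<Sum>j<J+3. (N j - n / 2 ^ j)\<^sup>2)"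
      proof -
        have "18 * (N J - n / 2 ^ J)\<^sup>2 \<le> 5184 * (N J - n / 2 ^ J)\<^sup>2" by simp
        then show ?thesis using fail_le[of J] by linarith
      qed
      finally show "9 * (real (length I))\<^sup>2 \<le> E" by (simp add: E_def)
    qed
  next
    case False
    then obtain j where j: "j < J" "w / 2 ^ Suc j < x" "x \<le> w / 2 ^ j"
      using real_between_consecutive[of x "\<lambda>j. w / 2 ^ j" J] less.prems(4) by auto
    define q :: real where "q = 1 / 2 ^ j"
    have q: "q > 0" by (simp add: q_def)
    have nq: "n / 2 ^ j = n * q" "n / 2 ^ (j + 3) = n * q / 8" "w / 2 ^ j = w * q"
      "w / 2 ^ Suc j = w * q / 2" "w / 2 ^ (j + 3) = w * q / 8"
      by (simp_all add: q_def power_add)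
    have jx: "w * q / 2 < x" "x \<le> w * q" using j(2,3) unfolding nq by simp_all
    \<comment> \<open>Level \<open>j\<close> bounds \<open>|I|\<close> from above. Level
      \<open>j + 3\<close>, at an eighth of the scale, supplies many entries far above a pivot close
      to \<open>u - x\<close>.\<close>
    consider "n * q / 2 \<le> \<bar>N j - n * q\<bar>" | "\<bar>N j - n * q\<bar> < n * q / 2" "n * q / 16 \<le> \<bar>N (j + 3) - n * q / 8\<bar>"
      | "\<bar>N j - n * q\<bar> < n * q / 2" "\<bar>N (j + 3) - n * q / 8\<bar> < n * q / 16"
      by linarith
    then show ?thesis
    proof cases
      case 1
      then have "real (length I) \<le> 24 * \<bar>N j - n / 2 ^ j\<bar>"
        using I_le[OF j(3)] abs_ge_self[of "N j - n * q"] abs_ge_zero[of "N j - n * q"]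
        unfolding nq by argo
      then show ?thesis by (rule by_deviation) (use j(1) in simp)
    next
      case 2
      have "real (length I) \<le> 24 * \<bar>N (j + 3) - n / 2 ^ (j + 3)\<bar>"
        using 2 I_le[OF j(3)] abs_ge_self[of "N j - n * q"] unfolding nq by argo
      then show ?thesis by (rule by_deviation) (use j(1) in simp)
    next
      case 3
      have I_nq: "real (length I) \<le> 3 / 2 * (n * q)" using I_le[OF j(3)] 3 by linarith
      have nqw: "0 \<le> n * q" using n q by simp
      \<comment> \<open>This is the hypothesis on \<open>J\<close> rescaled to level
        \<open>j\<close>, using \<open>4 ^ j * q * q = 1\<close>.\<close>
      have b_le: "b \<le> (w * q) * (n * q) / 256"
      proof -
        have "(4::real) ^ j = 2 ^ j * 2 ^ j" by (simp flip: power_mult_distrib)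
        then have "4 ^ j * q * q = 1" by (simp add: q_def)
        have "256 * b * 4 ^ j * (q * q) \<le> w * n * (q * q)"
          using J[OF j(1)] q by (intro mult_right_mono) auto
        also have "256 * b * 4 ^ j * (q * q) = 256 * b * (4 ^ j * q * q)" by (simp only: mult_ac)
        finally show ?thesis unfolding \<open>4 ^ j * q * q = 1\<close> by (simp add: mult_ac)
      qed
      \<comment> \<open>Otherwise every entry of \<open>I\<close> lies at most
        \<open>x / 400\<close> below \<open>p\<close>, while at least \<open>n * q / 16\<close>
        entries exceed \<open>p\<close> by \<open>w * q / 8\<close> or more. The excess balance then
        fails because \<open>1/256 + 3/800 < 1/128\<close>, which fixes the constants
        \<open>256\<close> and \<open>400\<close>.\<close>
      have p_ge: "u - 399 / 400 * x \<le> p"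
      proof (rule ccontr)
        assume contra: "\<not> ?thesis"
        let ?r = "u - w / 2 ^ (j + 3)"
        have rp: "w * q / 8 \<le> ?r - p"
          using contra jx unfolding nq by linarith
        have rpos: "p < ?r" using rp mult_pos_pos[OF w q] by linarith
        have N3: "n * q / 16 \<le> N (j + 3)"
          using 3(2) abs_ge_minus_self[of "N (j + 3) - n * q / 8"] by linarith
        have "(?r - p) * real (card {i\<in>A. ?r \<le> d i}) \<le> b + x / 400 * real (length I)"
        proof (rule balanced_excess[OF less.prems(1) A])
          show "p < ?r" by (rule rpos)
          show "0 \<le> x / 400" using less.prems(3) by simp
          show "p - d i \<le> x / 400" if "i \<in> set I" for i
            using less.prems(5)[OF that] contra by linarith
        qed
        then have "(?r - p) * N (j + 3) \<le> b + x / 400 * real (length I)" by (simp add: N_def)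
        moreover have "(w * q / 8) * (n * q / 16) \<le> (?r - p) * N (j + 3)"
          using rp rpos N3 nqw by (intro mult_mono) auto
        moreover have "(w * q / 8) * (n * q / 16) = (w * q) * (n * q) / 128" by simp
        moreover have "x / 400 * real (length I) \<le> w * q / 400 * (3 / 2 * (n * q))"
          using jx I_nq less.prems(3) w q by (intro mult_mono) auto
        moreover have "w * q / 400 * (3 / 2 * (n * q)) = (w * q) * (n * q) * (3 / 800)" by simp
        ultimately have *: "(w * q) * (n * q) / 128 \<le> b + (w * q) * (n * q) * (3 / 800)" by linarith
        have "0 \<le> (w * q) * (n * q)" using nqw w q by simp
        with * b_le b show False by linarith
      qed
      obtain I1 p1 c1 where pass: "condat_pass ordp d (I, p, c) = (I1, p1, c1)"
        by (metis surj_pair)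
      note P = condat_pass_balanced[OF perm b less.prems(1) pass]
      have "real c1 + 1 \<le> real c + 9 * real (length I)"
        using P(4) balanced_nonempty[OF less.prems(1) b] by linarith
      \<comment> \<open>Here \<open>x > w * q / 2\<close> turns the bound in terms of the dyadic
        scale into one in terms of \<open>x\<close>.\<close>
      also have "real (length I) \<le> 3 * (n * (x / w))"
      proof -
        have "q \<le> 2 * (x / w)" using jx w by (simp add: field_simps)
        from mult_left_mono[OF this n] I_nq show ?thesis by simp
      qed
      finally have cost: "real c1 + 1 \<le> real c + 27 * n * (x / w)" by simp
      show ?thesis
      proof (cases "length I > length I1")
        case True
        have "real c' \<le> real (c1 + 1) + 10800 * n * ((399 / 400 * x) / w) + E"
        proof (rule less.hyps[OF True P(1)])
          show "condat_loop ordp d (I1, p1, c1 + 1) = (I', p', c')"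
            using less.prems(2) True by (simp add: condat_loop_pass[OF pass])
          show "u - 399 / 400 * x \<le> d i" if "i \<in> set I1" for i using P(3)[OF that] p_ge by linarith
        qed (use less.prems in auto)
        \<comment> \<open>Contraction by \<open>399 / 400\<close> lowers the potential by
          \<open>10800 / 400 = 27\<close> units of \<open>n * (x / w)\<close>, exactly the bound for
          the pass.\<close>
        also have "10800 * n * ((399 / 400 * x) / w) = 10800 * n * (x / w) - 27 * n * (x / w)"
          by (simp add: field_simps)
        finally show ?thesis using cost by simp
      next
        case False
        then have "c' = c1 + 1" using less.prems(2) by (simp add: condat_loop_pass[OF pass])
        moreover have "0 \<le> E" by (simp add: E_def sum_nonneg)
        moreover have "0 \<le> n * (x / w)" using n w less.prems(3) by simp
        ultimately show ?thesis using cost by simp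
      qed
    qed
  qed
qed

section \<open>Filter\<close>

text \<open>The bound on the count pays for the eventual union with \<open>I_w\<close>: every index
  enters \<open>I_p\<close> once, so the length of \<open>I_p\<close> serves as potential.\<close>

lemma filter_step1_fold:
  assumes "1 \<le> n" and "fold (filter_step1 d b) [2..<n+1] ([1], [], d 1 - b, 4) = (Ip, Iw, p, c)"
  shows "balanced d b (set Ip) Ip p \<and> distinct (Ip @ Iw) \<and> set (Ip @ Iw) \<subseteq> {1..n}
    \<and> (\<forall>i\<in>{1..n} - set (Ip @ Iw). d i \<le> p) \<and> c + length Ip \<le> 13 * n"
  using assms
proof (induction n arbitrary: Ip Iw p c rule: dec_induct)
  case base
  then show ?case by (auto simp: balanced_def)
next
  case (step n)
  obtain Jp Jw q k where prev: "fold (filter_step1 d b) [2..<n+1] ([1], [], d 1 - b, 4) = (Jp, Jw, q, k)"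
    by (metis surj_pair)
  note IH = step.IH[OF prev]
  have "[2..<Suc n + 1] = [2..<n+1] @ [Suc n]" using step.hyps by simp
  then have eq: "filter_step1 d b (Suc n) (Jp, Jw, q, k) = (Ip, Iw, p, c)"
    using step.prems prev by (simp del: filter_step1.simps)
  have new: "Suc n \<notin> set (Jp @ Jw)" using IH by auto
  have split: "{1..Suc n} = insert (Suc n) {1..n}" by auto
  let ?q = "q + (d (Suc n) - q) / real (length Jp + 1)"
  consider "\<not> d (Suc n) > q" | "d (Suc n) > q" "?q > d (Suc n) - b"
    | "d (Suc n) > q" "\<not> ?q > d (Suc n) - b" by blast
  then show ?case
  proof cases
    case 1
    then have "Ip = Jp" "Iw = Jw" "p = q" "c = k + 2" using eq by auto
    then show ?thesis using IH 1 unfolding split by auto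
  next
    case 2
    then have *: "Ip = Jp @ [Suc n]" "Iw = Jw" "p = ?q" "c = k + 10" using eq by (auto simp: Let_def)
    have bal: "balanced d b (insert (Suc n) (set Jp)) Ip p" "q \<le> p"
      unfolding * using balanced_append[of d b "set Jp" Jp q "Suc n"] IH new 2(1) by auto
    then have "d i \<le> p" if "i \<in> {1..Suc n} - set (Ip @ Iw)" for i
    proof -
      have "d i \<le> q" using IH that unfolding * split by auto
      then show ?thesis using bal(2) by linarith
    qed
    then show ?thesis using IH new bal(1) unfolding * by auto
  next
    case 3
    \<comment> \<open>A restart raises \<open>c + length Ip\<close> by exactly \<open>13\<close>:
      the union costs \<open>length Jp\<close>, which the drop in length repays. This is the rate in
      the bound.\<close>
    then have *: "Ip = [Suc n]" "Iw = Jw @ Jp" "p = d (Suc n) - b" "c = k + 12 + length Jp"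
      using eq by (auto simp: Let_def)
    \<comment> \<open>The tentative pivot \<open>?q\<close> is used only for comparison: the failed
      test gives \<open>q \<le> ?q \<le> d (Suc n) - b\<close>, so a restart does not lower the
      pivot either.\<close>
    have "q \<le> ?q" using balanced_append(2)[of d b "set Jp" Jp q "Suc n"] IH new 3(1) by auto
    then have "q \<le> p" using 3(2) unfolding * by linarith
    then have "d i \<le> p" if "i \<in> {1..Suc n} - set (Ip @ Iw)" for i
    proof -
      have "d i \<le> q" using IH that unfolding * split by auto
      then show ?thesis using \<open>q \<le> p\<close> by linarith
    qed
    then show ?thesis using IH new unfolding * by (auto simp: balanced_def)
  qed
qed

text \<open>An index examined here either joins \<open>I\<close> or lies at or below the current
  pivot, hence below or at all later ones. So it may be added to \<open>A\<close> in both
  cases.\<close>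

lemma filter_step2_fold:
  assumes "balanced d b A I p" "distinct (I @ xs)" "A \<inter> set xs = {}"
    and "fold (filter_step2 d) xs (I, p, c) = (I', p', c')"
  shows "balanced d b (A \<union> set xs) I' p' \<and> p \<le> p' \<and> c' \<le> c + 7 * length xs"
  using assms
proof (induction xs arbitrary: A I p c)
  case Nil
  then show ?case by simp
next
  case (Cons i xs)
  show ?case
  proof (cases "d i > p")
    case True
    let ?p = "p + (d i - p) / real (length I + 1)"
    have "i \<notin> set I" using Cons.prems(2) by simp
    note bal = balanced_append[OF Cons.prems(1) this True]
    have "balanced d b (insert i A \<union> set xs) I' p' \<and> ?p \<le> p' \<and> c' \<le> (c + 7) + 7 * length xs"
      by (rule Cons.IH[OF bal(1)]) (use Cons.prems True in \<open>auto simp: Let_def add.commute\<close>)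
    then show ?thesis using bal(2) by auto
  next
    case False
    have "i \<notin> A" using Cons.prems(3) by simp
    then have "balanced d b (insert i A) I p"
      using Cons.prems(1) False by (auto simp: balanced_def)
    then have "balanced d b (insert i A \<union> set xs) I' p' \<and> p \<le> p' \<and> c' \<le> (c + 2) + 7 * length xs"
      by (rule Cons.IH) (use Cons.prems False in auto)
    then show ?thesis by auto
  qed
qed

lemma filter_simplex_balanced:
  assumes "\<And>xs. mset (ordw xs) = mset xs" and n: "1 \<le> n"
    and filt: "filter_simplex ordw n d b = (I, c)"
  obtains p where "balanced d b {1..n} I p" "c \<le> 20 * n"
proof -
  obtain Ip Iw p k where first: "fold (filter_step1 d b) [2..<n+1] ([1], [], d 1 - b, 4) = (Ip, Iw, p, k)"
    by (metis surj_pair)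
  obtain I' p' c' where second: "fold (filter_step2 d) (ordw Iw) (Ip, p, k) = (I', p', c')"
    by (metis surj_pair)
  have res: "I' = I" "c' = c" using filt unfolding filter_simplex_def first by (simp_all add: second)
  note F = filter_step1_fold[OF n first]
  have perm: "distinct (ordw Iw) = distinct Iw" "set (ordw Iw) = set Iw" "length (ordw Iw) = length Iw"
    using assms(1) mset_eq_imp_distinct_iff mset_eq_setD mset_eq_length by metis+
  \<comment> \<open>Indices in \<open>Iw\<close> may exceed \<open>p\<close>, so they stay outside
    \<open>A\<close> until the second loop has examined them.\<close>
  have "balanced d b ({1..n} - set Iw) Ip p"
    using F by (auto simp: balanced_def)
  then have G: "balanced d b (({1..n} - set Iw) \<union> set (ordw Iw)) I' p' \<and> p \<le> p' \<and> c' \<le> k + 7 * length (ordw Iw)"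
    by (rule filter_step2_fold[OF _ _ _ second]) (use F perm in auto)
  have "({1..n} - set Iw) \<union> set (ordw Iw) = {1..n}" using F perm by auto
  moreover have "length Iw \<le> n"
    using F card_mono[of "{1..n}" "set Iw"] distinct_card[of Iw] by auto
  ultimately show ?thesis using that[of p'] G F perm res by auto
qed

text \<open>Reduces the runtime to the loop: \<open>24 * n\<close> covers Filter with
  \<open>20 * n\<close> plus the initialisation, and \<open>4 * n\<close> covers the output.\<close>

lemma condat_runtime_loop:
  assumes ordw: "\<And>xs. mset (ordw xs) = mset xs" and ordp: "\<And>xs. mset (ordp xs) = mset xs"
    and b: "b > 0" and n: "1 \<le> n"
  obtains I p c I' p' c' where "balanced d b {1..n} I p"
    "condat_loop ordp d (I, p, c) = (I', p', c')" "c \<le> 24 * n"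
    "condat_runtime ordw ordp n d b \<le> c' + 4 * n"
proof -
  obtain I k where filt: "filter_simplex ordw n d b = (I, k)" by (metis surj_pair)
  obtain p where bal: "balanced d b {1..n} I p" and k: "k \<le> 20 * n"
    using filter_simplex_balanced[OF ordw n filt] by blast
  have pos: "length I > 0" using balanced_nonempty[OF bal b] .
  have I: "distinct I" "set I \<subseteq> {1..n}" using bal by (auto simp: balanced_def)
  then have len: "length I \<le> n"
    using card_mono[of "{1..n}" "set I"] distinct_card[of I] by auto
  have "(\<Sum>i\<leftarrow>I. d i) = b + real (length I) * p"
    using bal by (simp add: balanced_def sum_list_distinct_conv_sum_set)
  \<comment> \<open>Recomputing the pivot from \<open>I\<close> reproduces the one that Filter
    maintained, so the invariant holds at loop entry.\<close>
  then have p: "((\<Sum>i\<leftarrow>I. d i) - b) / real (length I) = p" using pos by simp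
  obtain I' p' c' where loop: "condat_loop ordp d (I, p, k + length I + 3) = (I', p', c')"
    by (metis surj_pair)
  have "length I' \<le> length I" using condat_loop_cost_square[OF ordp b bal loop] by simp
  moreover have "condat_runtime ordw ordp n d b = c' + 1 + 3 * length I'"
    unfolding condat_runtime_def condat_def filt by (simp add: p loop)
  ultimately show ?thesis
    using that[OF bal loop] k len n by simp
qed

text \<open>A deterministic bound for each \<open>n\<close>; it yields integrability of the
  runtime.\<close>

lemma condat_runtime_square:
  assumes "\<And>xs. mset (ordw xs) = mset xs" "\<And>xs. mset (ordp xs) = mset xs" "b > 0" "1 \<le> n"
  shows "condat_runtime ordw ordp n d b \<le> 28 * n + 9 * n\<^sup>2"
proof -
  obtain I p c I' p' c' where *: "balanced d b {1..n} I p"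
    "condat_loop ordp d (I, p, c) = (I', p', c')" "c \<le> 24 * n"
    "condat_runtime ordw ordp n d b \<le> c' + 4 * n"
    using condat_runtime_loop[OF assms] by metis
  have "length I \<le> n"
    using *(1) card_mono[of "{1..n}" "set I"] distinct_card[of I] by (auto simp: balanced_def)
  then have "(length I)\<^sup>2 \<le> n\<^sup>2" by (rule power_mono) simp
  with condat_loop_cost_square[OF assms(2,3) *(1,2)] *(3,4) show ?thesis by linarith
qed

text \<open>The loop bound with the initial distance \<open>x = u - l\<close>, and
  \<open>10828 = 10800 + 24 + 4\<close>.\<close>

lemma condat_runtime_dyadic:
  assumes "\<And>xs. mset (ordw xs) = mset xs" "\<And>xs. mset (ordp xs) = mset xs" "b > 0" "1 \<le> n"
    and lu: "l < u" and d: "\<And>i. i \<in> {1..n} \<Longrightarrow> l \<le> d i"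
    and J: "\<And>j. j < J \<Longrightarrow> 256 * b * 4 ^ j \<le> (u - l) * real n"
  shows "real (condat_runtime ordw ordp n d b) \<le> 10828 * real n + 18 * (real n / 2 ^ J)\<^sup>2
    + 5184 * (\<Sum>j<J+3. (real (card {i\<in>{1..n}. u - (u - l) / 2 ^ j \<le> d i}) - real n / 2 ^ j)\<^sup>2)"
proof -
  obtain I p c I' p' c' where *: "balanced d b {1..n} I p"
    "condat_loop ordp d (I, p, c) = (I', p', c')" "c \<le> 24 * n"
    "condat_runtime ordw ordp n d b \<le> c' + 4 * n"
    using condat_runtime_loop[OF assms(1-4)] by metis
  have "real c' \<le> real c + 10800 * real n * ((u - l) / (u - l)) + (18 * (real n / 2 ^ J)\<^sup>2
    + 5184 * (\<Sum>j<J+3. (real (card {i\<in>{1..n}. u - (u - l) / 2 ^ j \<le> d i}) - real n / 2 ^ j)\<^sup>2))"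
    by (rule condat_loop_cost_dyadic[OF assms(2,3) _ _ _ J *(1,2)])
      (use lu d *(1) in \<open>auto simp: balanced_def\<close>)
  then show ?thesis using *(3,4) lu by simp
qed

section \<open>Measurability of the runtime\<close>

lemma condat_step_fold_subset: "set (fst (fold (condat_step d) xs s)) \<subseteq> set (fst s)"
proof (induction xs arbitrary: s)
  case (Cons i xs)
  have "set (fst (condat_step d i s)) \<subseteq> set (fst s)"
    by (cases s) (auto simp: Let_def)
  then show ?case using Cons.IH[of "condat_step d i s"] by auto
qed simp

lemma condat_pass_cong:
  assumes "\<And>xs. mset (ordp xs) = mset xs" "\<And>i. i \<in> set I \<Longrightarrow> d i = d' i"
  shows "condat_pass ordp d (I, p, c) = condat_pass ordp d' (I, p, c)"
proof -
  have "set (ordp I) = set I" using assms(1) mset_eq_setD by metis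
  then have "fold (condat_step d) (ordp I) = fold (condat_step d') (ordp I)"
    using assms(2) by (intro ext fold_cong) (auto simp: fun_eq_iff)
  then show ?thesis by (simp add: condat_pass_def)
qed

lemma condat_loop_cong:
  assumes ordp: "\<And>xs. mset (ordp xs) = mset xs" and "\<And>i. i \<in> set I \<Longrightarrow> d i = d' i"
  shows "condat_loop ordp d (I, p, c) = condat_loop ordp d' (I, p, c)"
  using assms(2)
proof (induction "length I" arbitrary: I p c rule: less_induct)
  case less
  obtain I1 p1 c1 where pass: "condat_pass ordp d (I, p, c) = (I1, p1, c1)"
    by (metis surj_pair)
  then have pass': "condat_pass ordp d' (I, p, c) = (I1, p1, c1)"
    using condat_pass_cong[OF ordp, of I d d'] less.prems by simp
  have "set I1 \<subseteq> set I"
    using condat_step_fold_subset[of d "ordp I" "(I, p, c + length I)"] pass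
    by (simp add: condat_pass_def)
  then have "length I > length I1 \<Longrightarrow>
      condat_loop ordp d (I1, p1, c1 + 1) = condat_loop ordp d' (I1, p1, c1 + 1)"
    using less.prems by (intro less.hyps) auto
  then show ?case by (simp add: condat_loop_pass[OF pass] condat_loop_pass[OF pass'])
qed

text \<open>Allows entries outside \<open>{1..n}\<close>, about whose measurability nothing is
  assumed, to be replaced by \<open>0\<close>.\<close>

lemma condat_runtime_cong:
  assumes ordw: "\<And>xs. mset (ordw xs) = mset xs" and ordp: "\<And>xs. mset (ordp xs) = mset xs"
    and n: "1 \<le> n" and d: "\<And>i. i \<in> {1..n} \<Longrightarrow> d i = d' i"
  shows "condat_runtime ordw ordp n d b = condat_runtime ordw ordp n d' b"
proof -
  have "fold (filter_step1 d b) [2..<n+1] ([1], [], d 1 - b, 4)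
      = fold (filter_step1 d' b) [2..<n+1] ([1], [], d' 1 - b, 4)"
    using d n by (intro fold_cong) (auto simp: fun_eq_iff Let_def)
  moreover obtain Ip Iw p k where
    first: "fold (filter_step1 d b) [2..<n+1] ([1], [], d 1 - b, 4) = (Ip, Iw, p, k)"
    by (metis surj_pair)
  moreover have "set (ordw Iw) \<subseteq> {1..n}"
    using filter_step1_fold[OF n first] ordw[of Iw] mset_eq_setD[of "ordw Iw" Iw] by auto
  then have "fold (filter_step2 d) (ordw Iw) = fold (filter_step2 d') (ordw Iw)"
    using d by (intro ext fold_cong) (auto simp: fun_eq_iff)
  ultimately have filt: "filter_simplex ordw n d b = filter_simplex ordw n d' b"
    by (simp add: filter_simplex_def)
  obtain I k where I: "filter_simplex ordw n d' b = (I, k)" by (metis surj_pair)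
  obtain p where "balanced d' b {1..n} I p"
    using filter_simplex_balanced[OF ordw n I] by blast
  then have eq: "\<And>i. i \<in> set I \<Longrightarrow> d i = d' i" using d by (auto simp: balanced_def)
  then have "(\<Sum>i\<leftarrow>I. d i) = (\<Sum>i\<leftarrow>I. d' i)" by (metis map_cong)
  then show ?thesis
    unfolding condat_runtime_def condat_def filt I
    by (simp add: condat_loop_cong[OF ordp eq] split: prod.split)
qed

section \<open>Measurability of the states and of the operation count\<close>

text \<open>Index lists form a countable type, so it suffices to prove measurability for fixed lists;
  only \<open>p\<close> is a genuinely continuous quantity.\<close>

abbreviation pass_space :: "pass_state measure" where
  "pass_space \<equiv> count_space UNIV \<Otimes>\<^sub>M borel \<Otimes>\<^sub>M count_space UNIV"

abbreviation filter_space :: "filter_state measure" where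
  "filter_space \<equiv> count_space UNIV \<Otimes>\<^sub>M count_space UNIV \<Otimes>\<^sub>M borel \<Otimes>\<^sub>M count_space UNIV"

lemma measurable_pass_state:
  assumes S: "S \<in> M \<rightarrow>\<^sub>M pass_space"
    and F: "\<And>I p c. p \<in> borel_measurable M \<Longrightarrow> c \<in> M \<rightarrow>\<^sub>M count_space UNIV \<Longrightarrow>
      (\<lambda>\<omega>. F \<omega> (I, p \<omega>, c \<omega>)) \<in> M \<rightarrow>\<^sub>M N"
  shows "(\<lambda>\<omega>. F \<omega> (S \<omega>)) \<in> M \<rightarrow>\<^sub>M N"
proof -
  note [measurable] = S
  have "(\<lambda>\<omega>. F \<omega> (fst (S \<omega>), fst (snd (S \<omega>)), snd (snd (S \<omega>)))) \<in> M \<rightarrow>\<^sub>M N"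
  proof (rule measurable_compose_countable[where g="\<lambda>\<omega>. fst (S \<omega>)"])
    show "(\<lambda>\<omega>. F \<omega> (I, fst (snd (S \<omega>)), snd (snd (S \<omega>)))) \<in> M \<rightarrow>\<^sub>M N" for I
      by (rule F; measurable)
  qed measurable
  then show ?thesis by simp
qed

text \<open>Once \<open>Ip\<close> is fixed, the rest of the state has the shape of a
  \<open>pass_state\<close>.\<close>

lemma measurable_filter_state:
  assumes S: "S \<in> M \<rightarrow>\<^sub>M filter_space"
    and F: "\<And>Ip Iw p c. p \<in> borel_measurable M \<Longrightarrow> c \<in> M \<rightarrow>\<^sub>M count_space UNIV \<Longrightarrow>
      (\<lambda>\<omega>. F \<omega> (Ip, Iw, p \<omega>, c \<omega>)) \<in> M \<rightarrow>\<^sub>M N"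
  shows "(\<lambda>\<omega>. F \<omega> (S \<omega>)) \<in> M \<rightarrow>\<^sub>M N"
proof -
  note [measurable] = S
  have "(\<lambda>\<omega>. F \<omega> (fst (S \<omega>), snd (S \<omega>))) \<in> M \<rightarrow>\<^sub>M N"
  proof (rule measurable_compose_countable[where g="\<lambda>\<omega>. fst (S \<omega>)"])
    show "(\<lambda>\<omega>. F \<omega> (Ip, snd (S \<omega>))) \<in> M \<rightarrow>\<^sub>M N" for Ip
      by (rule measurable_pass_state[where S="\<lambda>\<omega>. snd (S \<omega>)"]) (auto intro!: F)
  qed measurable
  then show ?thesis by simp
qed

lemma measurable_fold:
  assumes "\<And>i T. i \<in> set xs \<Longrightarrow> T \<in> M \<rightarrow>\<^sub>M N \<Longrightarrow> (\<lambda>\<omega>. f \<omega> i (T \<omega>)) \<in> M \<rightarrow>\<^sub>M N"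
    and "S \<in> M \<rightarrow>\<^sub>M N"
  shows "(\<lambda>\<omega>. fold (f \<omega>) xs (S \<omega>)) \<in> M \<rightarrow>\<^sub>M N"
  using assms by (induction xs arbitrary: S) auto

context
  fixes d :: "nat \<Rightarrow> 'a \<Rightarrow> real" and M :: "'a measure"
  assumes d [measurable]: "\<And>i. d i \<in> borel_measurable M"
begin

lemma measurable_filter_step1:
  assumes "S \<in> M \<rightarrow>\<^sub>M filter_space"
  shows "(\<lambda>\<omega>. filter_step1 (\<lambda>i. d i \<omega>) b i (S \<omega>)) \<in> M \<rightarrow>\<^sub>M filter_space"
proof (rule measurable_filter_state[OF assms])
  fix Ip Iw and p :: "'a \<Rightarrow> real" and c :: "'a \<Rightarrow> nat"
  assume [measurable]: "p \<in> borel_measurable M" "c \<in> M \<rightarrow>\<^sub>M count_space UNIV"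
  show "(\<lambda>\<omega>. filter_step1 (\<lambda>i. d i \<omega>) b i (Ip, Iw, p \<omega>, c \<omega>)) \<in> M \<rightarrow>\<^sub>M filter_space"
    unfolding filter_step1.simps Let_def by measurable
qed

lemma measurable_filter_step2:
  assumes "S \<in> M \<rightarrow>\<^sub>M pass_space"
  shows "(\<lambda>\<omega>. filter_step2 (\<lambda>i. d i \<omega>) i (S \<omega>)) \<in> M \<rightarrow>\<^sub>M pass_space"
proof (rule measurable_pass_state[OF assms])
  fix I and p :: "'a \<Rightarrow> real" and c :: "'a \<Rightarrow> nat"
  assume [measurable]: "p \<in> borel_measurable M" "c \<in> M \<rightarrow>\<^sub>M count_space UNIV"
  show "(\<lambda>\<omega>. filter_step2 (\<lambda>i. d i \<omega>) i (I, p \<omega>, c \<omega>)) \<in> M \<rightarrow>\<^sub>M pass_space"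
    unfolding filter_step2.simps Let_def by measurable
qed

lemma measurable_condat_step:
  assumes "S \<in> M \<rightarrow>\<^sub>M pass_space"
  shows "(\<lambda>\<omega>. condat_step (\<lambda>i. d i \<omega>) i (S \<omega>)) \<in> M \<rightarrow>\<^sub>M pass_space"
proof (rule measurable_pass_state[OF assms])
  fix I and p :: "'a \<Rightarrow> real" and c :: "'a \<Rightarrow> nat"
  assume [measurable]: "p \<in> borel_measurable M" "c \<in> M \<rightarrow>\<^sub>M count_space UNIV"
  show "(\<lambda>\<omega>. condat_step (\<lambda>i. d i \<omega>) i (I, p \<omega>, c \<omega>)) \<in> M \<rightarrow>\<^sub>M pass_space"
    unfolding condat_step.simps Let_def by measurable
qed

text \<open>For a fixed list \<open>I\<close> the recursion continues only with shorter lists, so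
  induction on the length applies although the number of passes depends on the sample.\<close>

lemma measurable_condat_loop:
  assumes "p \<in> borel_measurable M" "c \<in> M \<rightarrow>\<^sub>M count_space UNIV"
  shows "(\<lambda>\<omega>. condat_loop ordp (\<lambda>i. d i \<omega>) (I, p \<omega>, c \<omega>)) \<in> M \<rightarrow>\<^sub>M pass_space"
  using assms
proof (induction "length I" arbitrary: I p c rule: less_induct)
  case less
  note [measurable] = less.prems
  define next_state where
    "next_state = (\<lambda>\<omega> (I1, p1, c1). if length I > length I1
      then condat_loop ordp (\<lambda>i. d i \<omega>) (I1, p1, c1 + 1) else (I1, p1, c1 + 1))"
  have "condat_loop ordp (\<lambda>i. d i \<omega>) (I, p \<omega>, c \<omega>)
      = next_state \<omega> (condat_pass ordp (\<lambda>i. d i \<omega>) (I, p \<omega>, c \<omega>))" for \<omega>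
    by (cases "condat_pass ordp (\<lambda>i. d i \<omega>) (I, p \<omega>, c \<omega>)")
      (simp add: condat_loop_pass next_state_def)
  moreover have "(\<lambda>\<omega>. condat_pass ordp (\<lambda>i. d i \<omega>) (I, p \<omega>, c \<omega>)) \<in> M \<rightarrow>\<^sub>M pass_space"
    unfolding condat_pass_def split
    by (rule measurable_fold, erule measurable_condat_step, measurable)
  then have "(\<lambda>\<omega>. next_state \<omega> (condat_pass ordp (\<lambda>i. d i \<omega>) (I, p \<omega>, c \<omega>))) \<in> M \<rightarrow>\<^sub>M pass_space"
  proof (rule measurable_pass_state)
    fix I1 and p1 :: "'a \<Rightarrow> real" and c1 :: "'a \<Rightarrow> nat"
    assume [measurable]: "p1 \<in> borel_measurable M" "c1 \<in> M \<rightarrow>\<^sub>M count_space UNIV"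
    show "(\<lambda>\<omega>. next_state \<omega> (I1, p1 \<omega>, c1 \<omega>)) \<in> M \<rightarrow>\<^sub>M pass_space"
    proof (cases "length I > length I1")
      case True
      then show ?thesis by (auto simp: next_state_def intro!: less.hyps)
    qed (simp add: next_state_def)
  qed
  ultimately show ?case by simp
qed

lemma measurable_filter_simplex:
  "(\<lambda>\<omega>. filter_simplex ordw n (\<lambda>i. d i \<omega>) b) \<in> M \<rightarrow>\<^sub>M count_space UNIV"
proof -
  define second where
    "second = (\<lambda>\<omega> (Ip, Iw, p, c). fold (filter_step2 (\<lambda>i. d i \<omega>)) (ordw Iw) (Ip, p, c))"
  have "(\<lambda>\<omega>. fold (filter_step1 (\<lambda>i. d i \<omega>) b) [2..<n+1] ([1], [], d 1 \<omega> - b, 4)) \<in> M \<rightarrow>\<^sub>M filter_space"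
    by (rule measurable_fold, erule measurable_filter_step1, measurable)
  then have "(\<lambda>\<omega>. second \<omega> (fold (filter_step1 (\<lambda>i. d i \<omega>) b) [2..<n+1] ([1], [], d 1 \<omega> - b, 4)))
      \<in> M \<rightarrow>\<^sub>M pass_space"
  proof (rule measurable_filter_state)
    fix Ip Iw and p :: "'a \<Rightarrow> real" and c :: "'a \<Rightarrow> nat"
    assume [measurable]: "p \<in> borel_measurable M" "c \<in> M \<rightarrow>\<^sub>M count_space UNIV"
    show "(\<lambda>\<omega>. second \<omega> (Ip, Iw, p \<omega>, c \<omega>)) \<in> M \<rightarrow>\<^sub>M pass_space"
      unfolding second_def split by (rule measurable_fold, erule measurable_filter_step2, measurable)
  qed
  \<comment> \<open>Dropping the real pivot leaves a value in a countable type, so the result is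
    measurable into a discrete space.\<close>
  then have "(\<lambda>\<omega>. case second \<omega> (fold (filter_step1 (\<lambda>i. d i \<omega>) b) [2..<n+1] ([1], [], d 1 \<omega> - b, 4))
      of (I, p, c) \<Rightarrow> (I, c)) \<in> M \<rightarrow>\<^sub>M count_space UNIV"
  proof (rule measurable_pass_state)
    fix I and p :: "'a \<Rightarrow> real" and c :: "'a \<Rightarrow> nat"
    assume c: "c \<in> M \<rightarrow>\<^sub>M count_space UNIV"
    have "(\<lambda>\<omega>. (I, c \<omega>)) \<in> M \<rightarrow>\<^sub>M count_space UNIV"
      using measurable_compose[OF c, of "\<lambda>k. (I, k)"] by simp
    then show "(\<lambda>\<omega>. case (I, p \<omega>, c \<omega>) of (I, p, c) \<Rightarrow> (I, c)) \<in> M \<rightarrow>\<^sub>M count_space UNIV"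
      by simp
  qed
  then show ?thesis
    unfolding filter_simplex_def second_def by (simp add: split_beta)
qed

lemma measurable_condat_runtime:
  "(\<lambda>\<omega>. condat_runtime ordw ordp n (\<lambda>i. d i \<omega>) b) \<in> M \<rightarrow>\<^sub>M count_space UNIV"
proof -
  define rest where "rest = (\<lambda>\<omega> (I, c). case condat_loop ordp (\<lambda>i. d i \<omega>)
    (I, ((\<Sum>i\<leftarrow>I. d i \<omega>) - b) / real (length I), c + length I + 3)
    of (I', p', c') \<Rightarrow> c' + 1 + 3 * length I')"
  \<comment> \<open>Filter has countably many possible results, so it suffices to treat the loop
    from each fixed one.\<close>
  have "(\<lambda>\<omega>. rest \<omega> (filter_simplex ordw n (\<lambda>i. d i \<omega>) b)) \<in> M \<rightarrow>\<^sub>M count_space UNIV"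
  proof (rule measurable_compose_countable[OF _ measurable_filter_simplex])
    fix x :: "nat list \<times> nat"
    obtain I c where x: "x = (I, c)" by (cases x)
    have "(\<lambda>\<omega>. \<Sum>i\<leftarrow>I. d i \<omega>) \<in> borel_measurable M"
      by (induction I) auto
    then have "(\<lambda>\<omega>. condat_loop ordp (\<lambda>i. d i \<omega>)
      (I, ((\<Sum>i\<leftarrow>I. d i \<omega>) - b) / real (length I), c + length I + 3)) \<in> M \<rightarrow>\<^sub>M pass_space"
      by (intro measurable_condat_loop) auto
    then show "(\<lambda>\<omega>. rest \<omega> x) \<in> M \<rightarrow>\<^sub>M count_space UNIV"
      unfolding x rest_def split by measurable
  qed
  moreover have "condat_runtime ordw ordp n (\<lambda>i. d i \<omega>) b = rest \<omega> (filter_simplex ordw n (\<lambda>i. d i \<omega>) b)" for \<omega>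
    by (simp add: condat_runtime_def condat_def rest_def Let_def split_beta)
  ultimately show ?thesis by simp
qed

end

section \<open>Expected squared deviations of the counts\<close>

context prob_space
begin

lemma indep_var_of_indep_vars:
  assumes "indep_vars (\<lambda>_. N) X I" "i \<in> I" "j \<in> I" "i \<noteq> j"
  shows "indep_var N (X i) N (X j)"
proof -
  have "indep_var (PiM {i} (\<lambda>_. N)) (\<lambda>\<omega>. restrict (\<lambda>i. X i \<omega>) {i})
      (PiM {j} (\<lambda>_. N)) (\<lambda>\<omega>. restrict (\<lambda>i. X i \<omega>) {j})"
    by (rule indep_var_restrict[OF assms(1)]) (use assms in auto)
  then have "indep_var N ((\<lambda>f. f i) \<circ> (\<lambda>\<omega>. restrict (\<lambda>i. X i \<omega>) {i}))
      N ((\<lambda>f. f j) \<circ> (\<lambda>\<omega>. restrict (\<lambda>i. X i \<omega>) {j}))"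
    by (rule indep_var_compose) auto
  then show ?thesis by (simp add: comp_def)
qed

text \<open>The expanded square of the centred count has vanishing cross terms by independence, and
  each diagonal term contributes \<open>q - q^2 \<le> q\<close>.\<close>

lemma expectation_count_deviation:
  assumes indep: "indep_vars (\<lambda>_. N) X A" and A: "finite A" and B: "B \<in> sets N"
    and q: "\<And>i. i \<in> A \<Longrightarrow> prob {\<omega>\<in>space M. X i \<omega> \<in> B} = q"
  shows "integrable M (\<lambda>\<omega>. (real (card {i\<in>A. X i \<omega> \<in> B}) - real (card A) * q)\<^sup>2)"
    and "expectation (\<lambda>\<omega>. (real (card {i\<in>A. X i \<omega> \<in> B}) - real (card A) * q)\<^sup>2) \<le> real (card A) * q"
proof -
  define Y :: "'b \<Rightarrow> 'a \<Rightarrow> real" where "Y = (\<lambda>i \<omega>. indicator B (X i \<omega>) - q)"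
  have X [measurable]: "X i \<in> M \<rightarrow>\<^sub>M N" if "i \<in> A" for i
    using indep that by (simp add: indep_vars_def)
  note B [measurable]
  have ind_int: "integrable M (\<lambda>\<omega>. indicator B (X i \<omega>) :: real)" if "i \<in> A" for i
    by (rule integrable_const_bound[where B=1]) (use that in \<open>auto simp: indicator_def\<close>)
  have ind_exp: "expectation (\<lambda>\<omega>. indicator B (X i \<omega>)) = q" if "i \<in> A" for i
  proof -
    have "expectation (\<lambda>\<omega>. indicator B (X i \<omega>) :: real)
        = expectation (indicator {\<omega>\<in>space M. X i \<omega> \<in> B})"
      by (intro Bochner_Integration.integral_cong) (auto simp: indicator_def)
    also have "\<dots> = q" using q[OF that] X[OF that] by simp
    finally show ?thesis .
  qed
  have Y_int: "integrable M (Y i)" and Y_exp: "expectation (Y i) = 0" if "i \<in> A" for i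
    using ind_int[OF that] ind_exp[OF that] by (simp_all add: Y_def prob_space)
  have YY: "integrable M (\<lambda>\<omega>. Y i \<omega> * Y j \<omega>)
      \<and> expectation (\<lambda>\<omega>. Y i \<omega> * Y j \<omega>) \<le> (if i = j then q else 0)"
    if "i \<in> A" "j \<in> A" for i j
  proof (cases "i = j")
    case True
    \<comment> \<open>An indicator equals its own square, so the square of \<open>Y i\<close> is
      affine in the indicator.\<close>
    have *: "Y i \<omega> * Y i \<omega> = (1 - 2 * q) * indicator B (X i \<omega>) + q\<^sup>2" for \<omega>
      by (simp add: Y_def indicator_def power2_eq_square algebra_simps)
    have "expectation (\<lambda>\<omega>. Y i \<omega> * Y i \<omega>) = (1 - 2 * q) * q + q\<^sup>2"
      unfolding * using ind_int[OF that(1)] ind_exp[OF that(1)] by (simp add: prob_space)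
    also have "\<dots> \<le> q" by (simp add: power2_eq_square algebra_simps)
    finally have "expectation (\<lambda>\<omega>. Y i \<omega> * Y i \<omega>) \<le> q" .
    moreover have "integrable M (\<lambda>\<omega>. Y i \<omega> * Y i \<omega>)"
      unfolding * using ind_int[OF that(1)] by simp
    ultimately show ?thesis using True by simp
  next
    case False
    have "indep_vars (\<lambda>_. borel) Y A"
      unfolding Y_def by (rule indep_vars_compose2[OF indep]) simp
    then have "indep_var borel (Y i) borel (Y j)"
      using that False by (rule indep_var_of_indep_vars)
    then show ?thesis
      using indep_var_integrable[of "Y i" "Y j"] indep_var_lebesgue_integral[of "Y i" "Y j"]
        False Y_int Y_exp that by simp
  qed
  have sq: "(real (card {i\<in>A. X i \<omega> \<in> B}) - real (card A) * q)\<^sup>2 = (\<Sum>i\<in>A. \<Sum>j\<in>A. Y i \<omega> * Y j \<omega>)" for \<omega>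
  proof -
    have "real (card {i\<in>A. X i \<omega> \<in> B}) = (\<Sum>i\<in>A. indicator B (X i \<omega>))"
      using A by (simp add: indicator_def sum.If_cases Int_def)
    then have "real (card {i\<in>A. X i \<omega> \<in> B}) - real (card A) * q = (\<Sum>i\<in>A. Y i \<omega>)"
      by (simp add: Y_def sum_subtractf)
    then show ?thesis by (simp add: power2_eq_square sum_product)
  qed
  show "integrable M (\<lambda>\<omega>. (real (card {i\<in>A. X i \<omega> \<in> B}) - real (card A) * q)\<^sup>2)"
    unfolding sq using YY by (intro Bochner_Integration.integrable_sum) auto
  have "expectation (\<lambda>\<omega>. (real (card {i\<in>A. X i \<omega> \<in> B}) - real (card A) * q)\<^sup>2)
      = (\<Sum>i\<in>A. \<Sum>j\<in>A. expectation (\<lambda>\<omega>. Y i \<omega> * Y j \<omega>))"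
    unfolding sq using YY
    by (simp add: Bochner_Integration.integral_sum Bochner_Integration.integrable_sum)
  also have "\<dots> \<le> (\<Sum>i\<in>A. \<Sum>j\<in>A. if i = j then q else 0)"
    using YY by (intro sum_mono) auto
  also have "\<dots> = real (card A) * q" using A by (simp add: sum.delta)
  finally show "expectation (\<lambda>\<omega>. (real (card {i\<in>A. X i \<omega> \<in> B}) - real (card A) * q)\<^sup>2) \<le> real (card A) * q" .
qed

end

section \<open>Uniform distribution and dyadic scales\<close>

lemma measure_uniform_upper_part:
  fixes l u t :: real
  assumes "l < u" "0 \<le> t" "t \<le> 1"
  shows "measure (uniform_measure lborel {l..u}) {u - (u - l) * t..} = t"
proof -
  have "(u - l) * t \<le> (u - l) * 1" using assms by (intro mult_left_mono) auto
  then have "l \<le> u - (u - l) * t" by (simp add: algebra_simps)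
  then have "{l..u} \<inter> {u - (u - l) * t..} = {u - (u - l) * t..u}" by auto
  then show ?thesis using assms by (subst measure_uniform_measure) auto
qed

lemma AE_uniform_measure_mem:
  fixes l u :: real
  shows "AE x in uniform_measure lborel {l..u}. x \<in> {l..u}"
  by (rule AE_uniform_measureI) auto

lemma sum_inverse_powers_le: "(\<Sum>j<k. x / 2 ^ j) \<le> 2 * x" if "x \<ge> 0" for x :: real
proof -
  have "(\<Sum>j<k. x / 2 ^ j) = 2 * x - 2 * x / 2 ^ k"
    by (induction k) (auto simp: field_simps)
  then show ?thesis using that by simp
qed

text \<open>The least \<open>J\<close> satisfying the first bound works. For
  \<open>y = 256 * b\<close> and \<open>x = (u - l) * n\<close> it marks the scale where
  \<open>(u - l) / 2 ^ J\<close> drops to order \<open>sqrt (b * (u - l) / n)\<close>.\<close>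

lemma dyadic_cutoff:
  fixes x y :: real
  assumes "y > 0"
  obtains J where "x \<le> y * 4 ^ J" "\<And>j. j < J \<Longrightarrow> y * 4 ^ j \<le> x"
proof -
  have "\<exists>J. x / y < 4 ^ J" by (rule real_arch_pow) simp
  then have ex: "\<exists>J. x \<le> y * 4 ^ J" using assms by (auto simp: field_simps intro: less_imp_le)
  show ?thesis
  proof (rule that[OF LeastI_ex[OF ex]])
    show "y * 4 ^ j \<le> x" if "j < (LEAST J. x \<le> y * 4 ^ J)" for j
      using not_less_Least[OF that] by simp
  qed
qed

section \<open>The expected runtime\<close>

theorem proposition2p4:
  fixes l u b :: real
    and M :: "nat \<Rightarrow> 'a measure"
    and d :: "nat \<Rightarrow> nat \<Rightarrow> 'a \<Rightarrow> real"
    and ordw ordp :: "nat list \<Rightarrow> nat list"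
  assumes "l < u" and "b > 0"
    and "\<And>xs. mset (ordw xs) = mset xs"
    and "\<And>xs. mset (ordp xs) = mset xs"
    and "\<And>n. n \<ge> 1 \<Longrightarrow> prob_space (M n)"
    and "\<And>n. n \<ge> 1 \<Longrightarrow> prob_space.indep_vars (M n) (\<lambda>_. borel) (d n) {1..n}"
    and "\<And>n i. n \<ge> 1 \<Longrightarrow> i \<in> {1..n} \<Longrightarrow>
           distr (M n) borel (d n i) = uniform_measure lborel {l..u}"
  shows "(\<forall>n\<ge>1. integrable (M n)
            (\<lambda>\<omega>. real (condat_runtime ordw ordp n (\<lambda>i. d n i \<omega>) b)))
       \<and> (\<lambda>n. \<integral>\<omega>. real (condat_runtime ordw ordp n (\<lambda>i. d n i \<omega>) b) \<partial>M n)
            \<in> O(\<lambda>n. real n)"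
proof -
  define R where "R = (\<lambda>n \<omega>. real (condat_runtime ordw ordp n (\<lambda>i. d n i \<omega>) b))"
  \<comment> \<open>The summands come from the deterministic part, from the scale \<open>J\<close>,
    and from the geometric series of variances.\<close>
  define K where "K = 10828 + 18 * (256 * b / (u - l)) + 5184 * 2"
  have main: "integrable (M n) (R n) \<and> (\<integral>\<omega>. R n \<omega> \<partial>M n) \<le> K * real n" if n: "n \<ge> 1" for n
  proof -
    interpret prob_space "M n" using assms(5)[OF n] .
    note indep = assms(6)[OF n]
    have d [measurable]: "d n i \<in> borel_measurable (M n)" if "i \<in> {1..n}" for i
      using indep that by (simp add: indep_vars_def)
    have "R n = (\<lambda>\<omega>. real (condat_runtime ordw ordp n (\<lambda>i. if i \<in> {1..n} then d n i \<omega> else 0) b))"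
      unfolding R_def
      by (intro ext arg_cong[where f=real] condat_runtime_cong[OF assms(3,4) n]) auto
    moreover have "(\<lambda>\<omega>. if i \<in> {1..n} then d n i \<omega> else 0) \<in> borel_measurable (M n)" for i
      by (cases "i \<in> {1..n}") auto
    note [measurable] = measurable_condat_runtime[OF this]
    ultimately have [measurable]: "R n \<in> borel_measurable (M n)" by simp
    have int: "integrable (M n) (R n)"
    proof (rule integrable_const_bound)
      show "AE \<omega> in M n. norm (R n \<omega>) \<le> real (28 * n + 9 * n\<^sup>2)"
        using condat_runtime_square[OF assms(3,4,2) n]
        by (auto simp: R_def simp del: of_nat_add of_nat_mult of_nat_power)
    qed simp
    obtain J where J: "(u - l) * real n \<le> 256 * b * 4 ^ J"
      "\<And>j. j < J \<Longrightarrow> 256 * b * 4 ^ j \<le> (u - l) * real n"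
      using dyadic_cutoff[of "256 * b" "(u - l) * real n"] assms(2) by auto
    \<comment> \<open>The first property of \<open>J\<close> makes a quadratic cost at the cutoff
      scale linear in \<open>n\<close>.\<close>
    have J': "(real n / 2 ^ J)\<^sup>2 \<le> 256 * b / (u - l) * real n"
    proof -
      have "(2 ^ J)\<^sup>2 = (4 ^ J :: real)" by (simp add: power2_eq_square flip: power_mult_distrib)
      then have "(real n / 2 ^ J)\<^sup>2 = real n * (real n / 4 ^ J)"
        by (simp add: power_divide power2_eq_square)
      also have "real n / 4 ^ J \<le> 256 * b / (u - l)"
        using J(1) assms(1) by (simp add: field_simps)
      then have "real n * (real n / 4 ^ J) \<le> real n * (256 * b / (u - l))"
        by (rule mult_left_mono) simp
      finally show ?thesis by (simp add: mult.commute)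
    qed
    define D where "D = (\<lambda>j \<omega>. (real (card {i\<in>{1..n}. u - (u - l) / 2 ^ j \<le> d n i \<omega>}) - real n / 2 ^ j)\<^sup>2)"
    have D: "integrable (M n) (D j) \<and> expectation (D j) \<le> real n / 2 ^ j" for j
    proof -
      have "prob {\<omega> \<in> space (M n). d n i \<omega> \<in> {u - (u - l) / 2 ^ j..}} = 1 / 2 ^ j"
        if i: "i \<in> {1..n}" for i
      proof -
        have "prob {\<omega> \<in> space (M n). d n i \<omega> \<in> {u - (u - l) / 2 ^ j..}}
            = measure (distr (M n) borel (d n i)) {u - (u - l) * (1 / 2 ^ j)..}"
          using d[OF i] by (subst measure_distr) (auto intro!: arg_cong[where f=prob])
        also have "\<dots> = 1 / 2 ^ j"
          unfolding assms(7)[OF n i] using assms(1) by (intro measure_uniform_upper_part) auto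
        finally show ?thesis .
      qed
      from expectation_count_deviation[OF indep _ _ this] show ?thesis
        by (simp add: D_def)
    qed
    \<comment> \<open>The uniform law puts the entries above \<open>l\<close> only almost surely, so
      the pathwise bound becomes an almost sure one.\<close>
    have "AE \<omega> in M n. \<forall>i\<in>{1..n}. l \<le> d n i \<omega>"
    proof (rule AE_finite_allI)
      fix i assume i: "i \<in> {1..n}"
      have "AE x in distr (M n) borel (d n i). x \<in> {l..u}"
        unfolding assms(7)[OF n i] by (rule AE_uniform_measure_mem)
      then have "AE \<omega> in M n. d n i \<omega> \<in> {l..u}" using d[OF i] by (rule AE_distrD[rotated])
      then show "AE \<omega> in M n. l \<le> d n i \<omega>" by eventually_elim auto
    qed simp
    then have "AE \<omega> in M n. R n \<omega> \<le> 10828 * real n + 18 * (real n / 2 ^ J)\<^sup>2 + 5184 * (\<Sum>j<J+3. D j \<omega>)"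
      unfolding R_def D_def
      by eventually_elim (rule condat_runtime_dyadic[OF assms(3,4,2) n assms(1) _ J(2)], auto)
    then have "expectation (R n) \<le> expectation (\<lambda>\<omega>. 10828 * real n + 18 * (real n / 2 ^ J)\<^sup>2 + 5184 * (\<Sum>j<J+3. D j \<omega>))"
      using D by (intro integral_mono_AE int) auto
    also have "\<dots> = 10828 * real n + 18 * (real n / 2 ^ J)\<^sup>2 + 5184 * (\<Sum>j<J+3. expectation (D j))"
      using D by (simp add: prob_space)
    also have "(\<Sum>j<J+3. expectation (D j)) \<le> (\<Sum>j<J+3. real n / 2 ^ j)"
      using D by (intro sum_mono) auto
    \<comment> \<open>This bound is uniform in \<open>J\<close>, which grows with
      \<open>n\<close>.\<close>
    also have "\<dots> \<le> 2 * real n" by (rule sum_inverse_powers_le) simp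
    finally have "expectation (R n) \<le> 10828 * real n + 18 * (256 * b / (u - l) * real n) + 5184 * (2 * real n)"
      using J' by linarith
    then show ?thesis using int by (simp add: K_def algebra_simps)
  qed
  have "(\<lambda>n. \<integral>\<omega>. R n \<omega> \<partial>M n) \<in> O(\<lambda>n. real n)"
  proof (rule bigoI)
    show "\<forall>\<^sub>F n in sequentially. norm (\<integral>\<omega>. R n \<omega> \<partial>M n) \<le> K * norm (real n)"
      using eventually_ge_at_top[of 1]
    proof eventually_elim
      case (elim n)
      have "0 \<le> (\<integral>\<omega>. R n \<omega> \<partial>M n)" by (intro integral_nonneg_AE) (simp add: R_def)
      then show ?case using main[OF elim] by simp
    qed
  qed
  with main show ?thesis unfolding R_def by blast
qed

end
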